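(* Let $k\geq 1$ be an integer and let $Q\in\mathbb{R}^{k\times k}$ be a symmetric positive definite matrix with associated norm $\|x\|_Q=\sqrt{x^TQx}$ on $\mathbb{R}^k$. An operator $f:\mathbb{R}^k\to\mathbb{R}^k$ is linear if and only if there exist an integer $m\geq 1$, a matrix $A\in\mathbb{R}^{m\times k}$, a linear function $b:\mathbb{R}^k\to\mathbb{R}^m$ and a linear function $c:\mathbb{R}^k\to\mathbb{R}^k$ such that, for every $v\in\mathbb{R}^k$, the system $Ax=b(v)$ has a solution $x\in\mathbb{R}^k$ and $f(v)=\hat{v}$, where $\hat{v}=\hat{v}(A,b,c)$ denotes the optimal solution of $$\min_{x\in\mathbb{R}^k,\ Ax=b(v)}\|c(v)-x\|_Q^2 .$$
   Context: $\mathbb{R}^k$ is the space of $k$-dimensional real column vectors. The symmetric positive definite matrix $Q$ defines the inner product $\langle x|y\rangle_Q=x^TQy$ on $\mathbb{R}^k$, with norm $\|x\|_Q=\sqrt{\langle x|x\rangle_Q}$. Whenever the system $Ax=b(v)$ has at least one solution, $\hat{v}$ is the uniquely determined best approximation of $c(v)$, in the norm $\|\cdot\|_Q$, within the solution set of $Ax=b(v)$. *)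

theory Defs
  imports Complex_Main "Jordan_Normal_Form.VS_Connect"
begin

text \<open>The space \<open>\<real>\<^sup>k\<close> is \<^term>\<open>carrier_vec k :: real vec set\<close>. A matrix with real
  entries, \<open>m\<close> rows and \<open>k\<close> columns is an element of \<^term>\<open>carrier_mat m k :: real mat set\<close>.\<close>

abbreviation linear_fun :: "nat \<Rightarrow> nat \<Rightarrow> (real vec \<Rightarrow> real vec) \<Rightarrow> bool" where
  "linear_fun n m \<equiv> linear_map class_ring (module_vec TYPE(real) n) (module_vec TYPE(real) m)"

lemma linear_fun_iff:
  "linear_fun n m f \<longleftrightarrow> f \<in> carrier_vec n \<rightarrow> carrier_vec m \<and>
     (\<forall>x \<in> carrier_vec n. \<forall>y \<in> carrier_vec n. f (x + y) = f x + f y) \<and>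
     (\<forall>r. \<forall>x \<in> carrier_vec n. f (r \<cdot>\<^sub>v x) = r \<cdot>\<^sub>v f x)"
proof -
  have vs: "vectorspace class_ring (module_vec TYPE(real) i)" for i
    by (rule vec_vs)
  then have "module class_ring (module_vec TYPE(real) i)" for i
    by (simp add: vectorspace_def)
  with vs show ?thesis
    by (auto simp: linear_map_def mod_hom_def mod_hom_axioms_def LinearCombinations.module_hom_def
        module_vec_simps)
qed

definition sym_pos_def :: "nat \<Rightarrow> real mat \<Rightarrow> bool" where
  "sym_pos_def k Q \<longleftrightarrow> Q \<in> carrier_mat k k \<and> transpose_mat Q = Q \<and>
     (\<forall>x \<in> carrier_vec k. x \<noteq> 0\<^sub>v k \<longrightarrow> x \<bullet> (Q *\<^sub>v x) > 0)"

definition inner_Q :: "real mat \<Rightarrow> real vec \<Rightarrow> real vec \<Rightarrow> real" where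
  "inner_Q Q x y = x \<bullet> (Q *\<^sub>v y)"

definition norm_Q :: "real mat \<Rightarrow> real vec \<Rightarrow> real" where
  "norm_Q Q x = sqrt (inner_Q Q x x)"

definition is_optimal :: "real mat \<Rightarrow> real mat \<Rightarrow> (real vec \<Rightarrow> real vec) \<Rightarrow>
    (real vec \<Rightarrow> real vec) \<Rightarrow> real vec \<Rightarrow> real vec \<Rightarrow> bool" where
  "is_optimal Q A b c v =
     is_arg_min (\<lambda>x. (norm_Q Q (c v - x))\<^sup>2)
       (\<lambda>x. x \<in> carrier_vec (dim_col A) \<and> A *\<^sub>v x = b v)"

text \<open>The description is proper whenever \<open>A x = b v\<close> is solvable and \<open>Q\<close> is symmetric positive
  definite: the feasible set is then a nonempty affine subspace and the objective is a strictly
  convex, coercive quadratic. For unsolvable systems the value is unspecified.\<close>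

definition vhat :: "real mat \<Rightarrow> real mat \<Rightarrow> (real vec \<Rightarrow> real vec) \<Rightarrow>
    (real vec \<Rightarrow> real vec) \<Rightarrow> real vec \<Rightarrow> real vec" where
  "vhat Q A b c v = (THE x. is_optimal Q A b c v x)"

end

theory Submission
  imports Defs
begin

text \<open>If \<open>f\<close> is linear, take \<open>A = I\<close> and \<open>b = f\<close>: the only feasible point is \<open>f v\<close>. Conversely, a
  feasible \<open>x\<close> for which \<open>c v - x\<close> is \<open>Q\<close>-orthogonal to the kernel of \<open>A\<close> is, by Pythagoras, the
  unique minimiser. These two conditions are linear in \<open>(b v, c v, x)\<close>, so the minimiser depends
  linearly on \<open>v\<close>, provided that it exists, that is, that \<open>Q\<close>-orthogonal projections exist.\<close>

context
  fixes k :: nat and Q :: "real mat"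
  assumes Q: "sym_pos_def k Q"
begin

section \<open>The inner product of \<open>Q\<close>\<close>

lemma Q_carrier [simp]: "Q \<in> carrier_mat k k"
  using Q by (simp add: sym_pos_def_def)

lemma inner_Q_commute:
  assumes "x \<in> carrier_vec k" "y \<in> carrier_vec k"
  shows "inner_Q Q x y = inner_Q Q y x"
proof -
  have "inner_Q Q x y = (Q\<^sup>T *\<^sub>v x) \<bullet> y"
    unfolding inner_Q_def using assms by (simp add: transpose_vec_mult_scalar[OF Q_carrier])
  also have "\<dots> = (Q *\<^sub>v x) \<bullet> y"
    using Q by (simp add: sym_pos_def_def)
  also have "\<dots> = inner_Q Q y x"
    unfolding inner_Q_def using assms mult_mat_vec_carrier[OF Q_carrier]
    by (metis comm_scalar_prod)
  finally show ?thesis .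
qed

lemma inner_Q_add_left:
  assumes "x \<in> carrier_vec k" "y \<in> carrier_vec k" "z \<in> carrier_vec k"
  shows "inner_Q Q (x + y) z = inner_Q Q x z + inner_Q Q y z"
  unfolding inner_Q_def using assms mult_mat_vec_carrier[OF Q_carrier]
  by (meson add_scalar_prod_distrib)

lemma inner_Q_add_right:
  assumes "x \<in> carrier_vec k" "y \<in> carrier_vec k" "z \<in> carrier_vec k"
  shows "inner_Q Q z (x + y) = inner_Q Q z x + inner_Q Q z y"
  using assms inner_Q_add_left by (metis add_carrier_vec inner_Q_commute)

lemma inner_Q_smult_left:
  assumes "x \<in> carrier_vec k" "z \<in> carrier_vec k"
  shows "inner_Q Q (r \<cdot>\<^sub>v x) z = r * inner_Q Q x z"
  unfolding inner_Q_def using assms mult_mat_vec_carrier[OF Q_carrier]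
  by (meson smult_scalar_prod_distrib)

lemma inner_Q_diff_left:
  assumes "x \<in> carrier_vec k" "y \<in> carrier_vec k" "z \<in> carrier_vec k"
  shows "inner_Q Q (x - y) z = inner_Q Q x z - inner_Q Q y z"
  unfolding inner_Q_def using assms mult_mat_vec_carrier[OF Q_carrier]
  by (meson minus_scalar_prod_distrib)

lemma inner_Q_pos:
  assumes "x \<in> carrier_vec k" "x \<noteq> 0\<^sub>v k"
  shows "inner_Q Q x x > 0"
  using assms Q by (simp add: inner_Q_def sym_pos_def_def)

lemma inner_Q_zero_left [simp]: "x \<in> carrier_vec k \<Longrightarrow> inner_Q Q (0\<^sub>v k) x = 0"
  unfolding inner_Q_def using mult_mat_vec_carrier[OF Q_carrier] by simp

lemma norm_Q_squared:
  assumes "x \<in> carrier_vec k"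
  shows "(norm_Q Q x)\<^sup>2 = inner_Q Q x x"
  using assms inner_Q_pos[of x] by (cases "x = 0\<^sub>v k") (auto simp: norm_Q_def)

section \<open>Existence of \<open>Q\<close>-orthogonal projections\<close>

text \<open>Riesz representation: positive definiteness forces the kernel of \<open>Q\<close> to be
  trivial, so \<open>Q\<close> is invertible and its inverse applied to \<open>a\<close> is the
  vector sought. An equation \<open>a \<bullet> x = 0\<close> thereby becomes a
  \<open>Q\<close>-orthogonality condition.\<close>

lemma inner_Q_representation:
  assumes "a \<in> carrier_vec k"
  obtains z where "z \<in> carrier_vec k" "\<And>x. x \<in> carrier_vec k \<Longrightarrow> inner_Q Q z x = a \<bullet> x"
proof -
  have "det Q \<noteq> 0"
  proof
    assume "det Q = 0"
    then obtain v where "v \<in> carrier_vec k" "v \<noteq> 0\<^sub>v k" "Q *\<^sub>v v = 0\<^sub>v k"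
      using det_0_iff_vec_prod_zero[OF Q_carrier] by blast
    with inner_Q_pos[of v] show False by (simp add: inner_Q_def)
  qed
  then obtain R where R: "R \<in> carrier_mat k k" "Q * R = 1\<^sub>m k"
    using det_non_zero_imp_unit[OF Q_carrier, of "()"] by (auto simp: Units_def ring_mat_simps)
  have z: "R *\<^sub>v a \<in> carrier_vec k" and "Q *\<^sub>v (R *\<^sub>v a) = a"
    using R assms by (auto simp flip: assoc_mult_mat_vec[OF Q_carrier])
  then have "inner_Q Q (R *\<^sub>v a) x = a \<bullet> x" if "x \<in> carrier_vec k" for x
    using that assms inner_Q_commute[OF z that] comm_scalar_prod[OF that assms]
    by (simp add: inner_Q_def)
  with z that show thesis by blast
qed

text \<open>Induction on the number of equations. A further equation \<open>a \<bullet> x = 0\<close> cuts out, inside the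
  subspace \<open>N\<close> found so far, the orthogonal complement of \<open>u\<close>, the projection to \<open>N\<close> of the vector
  representing \<open>a\<close>. So the new projection subtracts the component along \<open>u\<close>.\<close>

lemma orthogonal_projection_exists:
  assumes "set as \<subseteq> carrier_vec k" "y \<in> carrier_vec k"
  shows "\<exists>w \<in> carrier_vec k. (\<forall>a \<in> set as. a \<bullet> w = 0) \<and>
    (\<forall>n \<in> carrier_vec k. (\<forall>a \<in> set as. a \<bullet> n = 0) \<longrightarrow> inner_Q Q (y - w) n = 0)"
  using assms
proof (induction as arbitrary: y)
  case Nil
  then show ?case by (intro bexI[of _ y]) auto
next
  case (Cons a as)
  define N where "N = {x \<in> carrier_vec k. \<forall>a \<in> set as. a \<bullet> x = 0}"
  have a: "a \<in> carrier_vec k" and as: "set as \<subseteq> carrier_vec k" using Cons.prems by auto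
  have proj: "\<exists>w \<in> N. \<forall>n \<in> N. inner_Q Q (y - w) n = 0" if "y \<in> carrier_vec k" for y
    using Cons.IH[OF as that] by (auto simp: N_def)
  have N: "x \<in> carrier_vec k" if "x \<in> N" for x using that by (simp add: N_def)
  obtain z where z: "z \<in> carrier_vec k" "\<And>x. x \<in> carrier_vec k \<Longrightarrow> inner_Q Q z x = a \<bullet> x"
    using inner_Q_representation[OF a] by metis
  obtain u where u: "u \<in> N" "\<And>n. n \<in> N \<Longrightarrow> inner_Q Q (z - u) n = 0"
    using proj[OF z(1)] by blast
  \<comment> \<open>Since \<open>z - u\<close> is orthogonal to \<open>N\<close>, \<open>z\<close>
    and \<open>u\<close> induce the same functional there.\<close>
  have au: "a \<bullet> n = inner_Q Q u n" if "n \<in> N" for n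
    using u z that N by (metis inner_Q_diff_left eq_iff_diff_eq_0)
  obtain p where p: "p \<in> N" "\<And>n. n \<in> N \<Longrightarrow> inner_Q Q (y - p) n = 0"
    using proj[OF Cons.prems(2)] by blast
  \<comment> \<open>The Gram-Schmidt coefficient of \<open>p\<close> along \<open>u\<close>. If
    \<open>u\<close> is zero, division by zero gives \<open>t = 0\<close> and \<open>w = p\<close>;
    by \<open>au\<close>, \<open>a\<close> then vanishes on all of \<open>N\<close>.\<close>
  define t where "t = inner_Q Q p u / inner_Q Q u u"
  define w where "w = p - t \<cdot>\<^sub>v u"
  note carr = N[OF p(1)] N[OF u(1)] Cons.prems(2)
  have wc: "w \<in> carrier_vec k" using carr by (simp add: w_def)
  have wN: "w \<in> N"
  proof -
    have "a' \<bullet> w = 0" if "a' \<in> set as" for a'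
    proof -
      have a': "a' \<in> carrier_vec k" using that as by auto
      have "a' \<bullet> w = a' \<bullet> p - a' \<bullet> (t \<cdot>\<^sub>v u)"
        unfolding w_def using carr a' by (simp add: scalar_prod_minus_distrib)
      then show ?thesis using carr a' that p(1) u(1) by (simp add: N_def)
    qed
    with wc show ?thesis by (simp add: N_def)
  qed
  have "inner_Q Q w u = 0"
  proof (cases "u = 0\<^sub>v k")
    case True
    then show ?thesis using wc inner_Q_commute[of w u] by simp
  next
    case False
    then show ?thesis
      using inner_Q_pos[of u] carr
      by (simp add: w_def inner_Q_diff_left inner_Q_smult_left t_def)
  qed
  then have aw: "a \<bullet> w = 0" using au[OF wN] inner_Q_commute[OF wc carr(2)] by simp
  \<comment> \<open>Here \<open>y - w\<close> is \<open>y - p\<close> plus \<open>t\<close> times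
    \<open>u\<close>; the first is orthogonal to all of \<open>N\<close>, the second to those
    \<open>n\<close> on which \<open>a\<close> vanishes.\<close>
  have "inner_Q Q (y - w) n = 0" if n: "n \<in> N" "a \<bullet> n = 0" for n
  proof -
    have "inner_Q Q (y - w) n = inner_Q Q (y - p) n + t * inner_Q Q u n"
      using carr wc N[OF n(1)]
      by (simp add: inner_Q_diff_left inner_Q_smult_left w_def)
    then show ?thesis using p(2)[OF n(1)] au[OF n(1)] n(2) by simp
  qed
  with wN aw show ?case by (intro bexI[of _ w]) (auto simp: N_def)
qed

section \<open>Projections onto solution sets and their minimality\<close>

lemma mult_mat_vec_eq_zero_iff:
  assumes "A \<in> carrier_mat m k"
  shows "A *\<^sub>v x = 0\<^sub>v m \<longleftrightarrow> (\<forall>a \<in> set (rows A). a \<bullet> x = 0)"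
  using assms by (auto simp: rows_def vec_eq_iff)

text \<open>The normal equations of the minimisation problem: the residual is orthogonal to the
  directions of the feasible affine space. Unlike minimality, this condition visibly survives sums
  and scalar multiples of \<open>(d, y, x)\<close>.\<close>

definition is_projection :: "real mat \<Rightarrow> real vec \<Rightarrow> real vec \<Rightarrow> real vec \<Rightarrow> bool" where
  "is_projection A d y x \<longleftrightarrow> x \<in> carrier_vec k \<and> A *\<^sub>v x = d \<and>
     (\<forall>n \<in> carrier_vec k. A *\<^sub>v n = 0\<^sub>v (dim_row A) \<longrightarrow> inner_Q Q (y - x) n = 0)"

text \<open>Translation by the particular solution \<open>x0\<close> reduces the affine problem to
  projecting \<open>y - x0\<close> onto the kernel of \<open>A\<close>.\<close>

lemma is_projection_exists:
  assumes A: "A \<in> carrier_mat m k" and y: "y \<in> carrier_vec k"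
    and x0: "x0 \<in> carrier_vec k" "A *\<^sub>v x0 = d"
  shows "\<exists>x. is_projection A d y x"
proof -
  have "set (rows A) \<subseteq> carrier_vec k" "y - x0 \<in> carrier_vec k"
    using A y x0 by (auto simp: rows_def)
  then obtain w where w: "w \<in> carrier_vec k" "A *\<^sub>v w = 0\<^sub>v m"
    "\<And>n. n \<in> carrier_vec k \<Longrightarrow> A *\<^sub>v n = 0\<^sub>v m \<Longrightarrow> inner_Q Q (y - x0 - w) n = 0"
    using orthogonal_projection_exists mult_mat_vec_eq_zero_iff[OF A] by metis
  have "y - (x0 + w) = y - x0 - w" using y x0 w by auto
  moreover have "A *\<^sub>v (x0 + w) = d"
    using x0 w A by (auto simp: mult_add_distrib_mat_vec[OF A])
  ultimately show ?thesis
    using x0 w A by (intro exI[of _ "x0 + w"]) (auto simp: is_projection_def)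
qed

text \<open>Pythagoras for \<open>y - z = (y - x) + (x - z)\<close>: the second summand lies in the
  kernel of \<open>A\<close>, and it is nonzero, which makes the inequality strict.\<close>

lemma is_projection_less:
  assumes A: "A \<in> carrier_mat m k" and y: "y \<in> carrier_vec k"
    and x: "is_projection A d y x" and z: "z \<in> carrier_vec k" "A *\<^sub>v z = d" "z \<noteq> x"
  shows "(norm_Q Q (y - x))\<^sup>2 < (norm_Q Q (y - z))\<^sup>2"
proof -
  define n where "n = x - z"
  have xc: "x \<in> carrier_vec k" "A *\<^sub>v x = d" using x by (auto simp: is_projection_def)
  have n: "n \<in> carrier_vec k" using xc z by (simp add: n_def)
  have d: "d \<in> carrier_vec m" using z A by auto
  have "A *\<^sub>v n = 0\<^sub>v m"
    using d by (simp add: n_def mult_minus_distrib_mat_vec[OF A xc(1) z(1)] xc z)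
  then have orth: "inner_Q Q (y - x) n = 0" using x n A by (simp add: is_projection_def)
  have "n \<noteq> 0\<^sub>v k"
  proof
    assume "n = 0\<^sub>v k"
    then have "n + z = z" using z by simp
    moreover have "n + z = x" using xc z by (auto simp: n_def)
    ultimately show False using z(3) by simp
  qed
  then have pos: "inner_Q Q n n > 0" using inner_Q_pos n by blast
  have yx: "y - x \<in> carrier_vec k" using y xc by simp
  have eq: "y - z = (y - x) + n" using y xc z by (auto simp: n_def)
  have "inner_Q Q (y - z) (y - z) = inner_Q Q (y - x) (y - x) + inner_Q Q n n"
    unfolding eq using yx n orth
    by (simp add: inner_Q_add_left inner_Q_add_right inner_Q_commute[OF n yx])
  with pos y xc z show ?thesis by (simp add: norm_Q_squared)
qed

text \<open>The strict inequality serves twice: no feasible point beats \<open>x\<close>, and every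
  other feasible point is beaten by \<open>x\<close>, so the definite description denotes
  \<open>x\<close>.\<close>

lemma vhat_eqI:
  assumes A: "A \<in> carrier_mat m k" and cv: "c v \<in> carrier_vec k"
    and x: "is_projection A (b v) (c v) x"
  shows "vhat Q A b c v = x"
  unfolding vhat_def
proof (rule the_equality)
  have xc: "x \<in> carrier_vec k" "A *\<^sub>v x = b v" using x by (auto simp: is_projection_def)
  note less = is_projection_less[OF A cv x]
  show "is_optimal Q A b c v x"
    unfolding is_optimal_def is_arg_min_def using less xc A by (metis carrier_matD(2) less_asym less_irrefl)
  show "z = x" if "is_optimal Q A b c v z" for z
    using that less[of z] xc A unfolding is_optimal_def is_arg_min_def by (metis carrier_matD(2))
qed

section \<open>Linear dependence of the projection on the data\<close>

lemma is_projection_add: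
  assumes A: "A \<in> carrier_mat m k" and "y \<in> carrier_vec k" "y' \<in> carrier_vec k"
    and "is_projection A d y x" "is_projection A d' y' x'"
  shows "is_projection A (d + d') (y + y') (x + x')"
proof -
  have x: "x \<in> carrier_vec k" "x' \<in> carrier_vec k" using assms by (auto simp: is_projection_def)
  then have "y + y' - (x + x') = (y - x) + (y' - x')" using assms(2,3) by auto
  then show ?thesis
    using assms x
    by (auto simp: is_projection_def mult_add_distrib_mat_vec[OF A] inner_Q_add_left)
qed

lemma is_projection_smult:
  assumes A: "A \<in> carrier_mat m k" and "y \<in> carrier_vec k" and "is_projection A d y x"
  shows "is_projection A (r \<cdot>\<^sub>v d) (r \<cdot>\<^sub>v y) (r \<cdot>\<^sub>v x)"
proof -
  have x: "x \<in> carrier_vec k" using assms by (auto simp: is_projection_def)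
  then have "r \<cdot>\<^sub>v y - r \<cdot>\<^sub>v x = r \<cdot>\<^sub>v (y - x)" using assms(2) by (auto simp: algebra_simps)
  then show ?thesis
    using assms x by (auto simp: is_projection_def mult_mat_vec[OF A] inner_Q_smult_left)
qed

lemma linear_fun_vhat:
  assumes A: "A \<in> carrier_mat m k" and b: "linear_fun k m b" and c: "linear_fun k k c"
    and f: "f \<in> carrier_vec k \<rightarrow> carrier_vec k"
    and sol: "\<And>v. v \<in> carrier_vec k \<Longrightarrow> \<exists>x \<in> carrier_vec k. A *\<^sub>v x = b v"
    and fv: "\<And>v. v \<in> carrier_vec k \<Longrightarrow> f v = vhat Q A b c v"
  shows "linear_fun k k f"
proof -
  have cc: "c v \<in> carrier_vec k" if "v \<in> carrier_vec k" for v
    using c that by (auto simp: linear_fun_iff)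
  \<comment> \<open>A vector satisfying the projection condition at \<open>v\<close> must be
    \<open>f v\<close>. Each linearity law for \<open>f\<close> thus reduces to checking that its
    right-hand side satisfies this condition.\<close>
  have f_eq: "f v = x" if "is_projection A (b v) (c v) x" "v \<in> carrier_vec k" for v x
    using vhat_eqI[where b = b and c = c and v = v, OF A cc that(1)] that fv by simp
  have proj: "is_projection A (b v) (c v) (f v)" if v: "v \<in> carrier_vec k" for v
    using is_projection_exists[OF A cc] sol f_eq v by metis
  show ?thesis
    unfolding linear_fun_iff
  proof (intro conjI ballI allI f f_eq)
    fix v w :: "real vec" assume vw: "v \<in> carrier_vec k" "w \<in> carrier_vec k"
    then have "b (v + w) = b v + b w" "c (v + w) = c v + c w"
      using b c by (auto simp: linear_fun_iff)
    then show "is_projection A (b (v + w)) (c (v + w)) (f v + f w)"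
      using is_projection_add[OF A cc cc proj proj] vw by simp
  next
    fix r :: real and v :: "real vec" assume v: "v \<in> carrier_vec k"
    then have "b (r \<cdot>\<^sub>v v) = r \<cdot>\<^sub>v b v" "c (r \<cdot>\<^sub>v v) = r \<cdot>\<^sub>v c v"
      using b c by (auto simp: linear_fun_iff)
    then show "is_projection A (b (r \<cdot>\<^sub>v v)) (c (r \<cdot>\<^sub>v v)) (r \<cdot>\<^sub>v f v)"
      using is_projection_smult[OF A cc proj] v by simp
  qed auto
qed

end

theorem theorem2p1:
  fixes k :: nat and Q :: "real mat" and f :: "real vec \<Rightarrow> real vec"
  assumes "k \<ge> 1"
    and "sym_pos_def k Q"
    and "f \<in> carrier_vec k \<rightarrow> carrier_vec k"
  shows "linear_fun k k f \<longleftrightarrow>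
    (\<exists>(m::nat) (A::real mat) (b::real vec \<Rightarrow> real vec) (c::real vec \<Rightarrow> real vec).
       m \<ge> 1 \<and> A \<in> carrier_mat m k \<and> linear_fun k m b \<and> linear_fun k k c \<and>
       (\<forall>v \<in> carrier_vec k.
          (\<exists>x \<in> carrier_vec k. A *\<^sub>v x = b v) \<and> f v = vhat Q A b c v))"
    (is "_ \<longleftrightarrow> ?rhs")
proof
  assume lin: "linear_fun k k f"
  \<comment> \<open>With \<open>c = f\<close> too, the residual at \<open>f v\<close> is zero, so
    orthogonality is immediate. The choice \<open>m = k\<close> is admissible because
    \<open>k \<ge> 1\<close>.\<close>
  have "(\<exists>x \<in> carrier_vec k. 1\<^sub>m k *\<^sub>v x = f v) \<and> f v = vhat Q (1\<^sub>m k) f f v"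
    if v: "v \<in> carrier_vec k" for v
  proof -
    have fv: "f v \<in> carrier_vec k" using assms(3) v by auto
    then have "is_projection k Q (1\<^sub>m k) (f v) (f v) (f v)"
      by (simp add: is_projection_def[OF assms(2)] inner_Q_zero_left[OF assms(2)])
    then have "vhat Q (1\<^sub>m k) f f v = f v"
      by (rule vhat_eqI[where b = f and c = f and v = v, OF assms(2) one_carrier_mat fv])
    with fv show ?thesis by auto
  qed
  with lin assms(1) show ?rhs
    by (intro exI[of _ k] exI[of _ "1\<^sub>m k"] exI[of _ f] conjI one_carrier_mat) blast+
next
  assume ?rhs
  then show "linear_fun k k f"
    using linear_fun_vhat[OF assms(2) _ _ _ assms(3)] by blast
qed

end
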